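(* Let $ABCD$ be a convex equidiagonal kite with $AB=BC$ and $AD=CD$, and let $E$ be the Steiner point of $ABCD$. Let $F$, $G$, $H$, and $I$ be the inner Vecten points ($X_{486}$ points) of $\triangle EAB$, $\triangle EBC$, $\triangle ECD$, and $\triangle EDA$, respectively. Then $FGHI$ is a square congruent to the Varignon parallelogram of $ABCD$ and $$[ABCD]=2[FGHI].$$
   Context: A kite is a quadrilateral with two pairs of adjacent equal sides. A quadrilateral is equidiagonal if its diagonals have equal length. A midray circle of a quadrilateral is the circle through the midpoints of the line segments joining one vertex of the quadrilateral to the other three vertices; the Steiner point of a quadrilateral is the common point of its four midray circles. $X_n$ denotes the $n$th triangle center in Kimberling's Encyclopedia of Triangle Centers; the inner Vecten point $X_{486}$ of a triangle is the point of concurrence of the lines joining each vertex to the center of the square erected internally (inwards) on the opposite side. The Varignon parallelogram of $ABCD$ is the parallelogram whose vertices are the midpoints of the sides $AB$, $BC$, $CD$, $DA$. $[XYZW]$ denotes the area of the quadrilateral $XYZW$. *)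

theory Defs
  imports "HOL-Analysis.Analysis"
begin

type_synonym point = "real^2"

text \<open>\<open>X\<close> and \<open>Y\<close> lie strictly on the same side of the line \<open>PQ\<close>.\<close>
definition same_side :: "point \<Rightarrow> point \<Rightarrow> point \<Rightarrow> point \<Rightarrow> bool" where
  "same_side P Q X Y \<longleftrightarrow> closed_segment X Y \<inter> affine hull {P, Q} = {}"

text \<open>The remaining vertices lie strictly on one side of each side line. This also excludes
  crossed quadrilaterals and triples of collinear vertices.\<close>
definition convex_quadrilateral :: "point \<Rightarrow> point \<Rightarrow> point \<Rightarrow> point \<Rightarrow> bool" where
  "convex_quadrilateral A B C D \<longleftrightarrow>
     same_side A B C D \<and> same_side B C D A \<and> same_side C D A B \<and> same_side D A B C"

definition kite :: "point \<Rightarrow> point \<Rightarrow> point \<Rightarrow> point \<Rightarrow> bool" where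
  "kite A B C D \<longleftrightarrow>
     dist A B = dist B C \<and> dist C D = dist D A \<or>
     dist B C = dist C D \<and> dist D A = dist A B"

definition equidiagonal :: "point \<Rightarrow> point \<Rightarrow> point \<Rightarrow> point \<Rightarrow> bool" where
  "equidiagonal A B C D \<longleftrightarrow> dist A C = dist B D"

definition square :: "point \<Rightarrow> point \<Rightarrow> point \<Rightarrow> point \<Rightarrow> bool" where
  "square P Q R S \<longleftrightarrow>
     P \<noteq> Q \<and> dist P Q = dist Q R \<and> dist Q R = dist R S \<and> dist R S = dist S P \<and>
     orthogonal (S - P) (Q - P) \<and> orthogonal (P - Q) (R - Q) \<and>
     orthogonal (Q - R) (S - R) \<and> orthogonal (R - S) (P - S)"

text \<open>The circle through the midpoints of \<open>VX\<close>, \<open>VY\<close>, \<open>VZ\<close>; it exists and is unique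
  whenever \<open>X\<close>, \<open>Y\<close>, \<open>Z\<close> are not collinear.\<close>
definition midray_circle :: "point \<Rightarrow> point \<Rightarrow> point \<Rightarrow> point \<Rightarrow> point set \<Rightarrow> bool" where
  "midray_circle V X Y Z K \<longleftrightarrow>
     (\<exists>c r. r > 0 \<and> K = sphere c r) \<and>
     midpoint V X \<in> K \<and> midpoint V Y \<in> K \<and> midpoint V Z \<in> K"

definition steiner_point :: "point \<Rightarrow> point \<Rightarrow> point \<Rightarrow> point \<Rightarrow> point \<Rightarrow> bool" where
  "steiner_point A B C D E \<longleftrightarrow>
     (\<exists>K\<^sub>A K\<^sub>B K\<^sub>C K\<^sub>D.
        midray_circle A B C D K\<^sub>A \<and> midray_circle B C D A K\<^sub>B \<and>
        midray_circle C D A B K\<^sub>C \<and> midray_circle D A B C K\<^sub>D \<and>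
        E \<in> K\<^sub>A \<inter> K\<^sub>B \<inter> K\<^sub>C \<inter> K\<^sub>D)"

text \<open>\<open>M\<close> is the center of the square erected on the side \<open>QR\<close> of the triangle \<open>PQR\<close>,
  on the same side of \<open>QR\<close> as \<open>P\<close>.\<close>
definition inner_square_center :: "point \<Rightarrow> point \<Rightarrow> point \<Rightarrow> point \<Rightarrow> bool" where
  "inner_square_center P Q R M \<longleftrightarrow>
     (\<exists>S T. square Q R S T \<and> same_side Q R P S \<and> M = midpoint Q S)"

text \<open>An isosceles right triangle has no inner Vecten point (the barycentric coordinates of
  \<open>X\<^sub>4\<^sub>8\<^sub>6\<close> become \<open>0 : 0 : 0\<close>): the inner square on the hypotenuse is centered at the opposite
  vertex, so no line joins the two, whereas the other two lines both coincide with the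
  hypotenuse. The predicate is then false, since the affine hull of the doubled vertex is a
  single point off the hypotenuse. For every other nondegenerate
  triangle at most one point satisfies it.
  In particular, if \<open>ABCD\<close> is a square, its Steiner point \<open>E\<close> is its center, so
  \<open>EAB\<close>, \<open>EBC\<close>, \<open>ECD\<close>, \<open>EDA\<close> are isosceles right and have no inner Vecten points.\<close>
definition inner_vecten_point :: "point \<Rightarrow> point \<Rightarrow> point \<Rightarrow> point \<Rightarrow> bool" where
  "inner_vecten_point P Q R X \<longleftrightarrow>
     (\<exists>M\<^sub>P M\<^sub>Q M\<^sub>R.
        inner_square_center P Q R M\<^sub>P \<and> inner_square_center Q R P M\<^sub>Q \<and>
        inner_square_center R P Q M\<^sub>R \<and>
        X \<in> affine hull {P, M\<^sub>P} \<inter> affine hull {Q, M\<^sub>Q} \<inter> affine hull {R, M\<^sub>R})"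

text \<open>The region bounded by a quadrilateral; only meaningful for convex quadrilaterals.\<close>
definition quad_region :: "point \<Rightarrow> point \<Rightarrow> point \<Rightarrow> point \<Rightarrow> point set" where
  "quad_region A B C D = convex hull {A, B, C, D}"

definition quad_area :: "point \<Rightarrow> point \<Rightarrow> point \<Rightarrow> point \<Rightarrow> real" where
  "quad_area A B C D = measure lebesgue (quad_region A B C D)"

definition varignon_region :: "point \<Rightarrow> point \<Rightarrow> point \<Rightarrow> point \<Rightarrow> point set" where
  "varignon_region A B C D =
     quad_region (midpoint A B) (midpoint B C) (midpoint C D) (midpoint D A)"

definition congruent_figures :: "point set \<Rightarrow> point set \<Rightarrow> bool" where
  "congruent_figures S T \<longleftrightarrow>
     (\<exists>f :: point \<Rightarrow> point. (\<forall>x y. dist (f x) (f y) = dist x y) \<and> f ` S = T)"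

end

theory Submission
  imports Defs
begin

text \<open>
  Since \<open>AB = BC\<close> and \<open>AD = CD\<close>, the diagonal \<open>BD\<close> lies on the perpendicular bisector of
  \<open>AC\<close>. Let \<open>Z\<close> be the midpoint of \<open>AC\<close>, and let \<open>p\<close>, \<open>q\<close> be half the vectors from \<open>C\<close> to \<open>A\<close>
  and from \<open>D\<close> to \<open>B\<close>. Then \<open>p\<close> and \<open>q\<close> are orthogonal and, the diagonals being equal, of
  the same length. In this frame \<open>A, C = Z \<plusminus> p\<close>, \<open>B = Z + b q\<close> and \<open>D = Z + (b - 2) q\<close>, and
  convexity means \<open>0 < b < 2\<close> (\<open>convex_equidiagonal_kite_frame\<close>).

  The Steiner point is the midpoint of \<open>BD\<close>: the midray circles of \<open>B\<close> and \<open>D\<close> both pass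
  through that midpoint, both are symmetric about \<open>BD\<close>, and they lie on opposite sides of the
  perpendicular to \<open>BD\<close> there; so they touch at it and have no other common point
  (\<open>steiner_point_kite\<close>).

  Hence in each of the triangles \<open>EAB\<close>, \<open>EBC\<close>, \<open>ECD\<close>, \<open>EDA\<close> the side on \<open>BD\<close> is a vector
  \<open>u = \<plusminus> q\<close> from \<open>E\<close>, and the altitude from the opposite vertex is \<open>v = \<plusminus> p\<close>, of the same
  length as \<open>u\<close>. In such a triangle the inner Vecten point is \<open>E + (u + v)/2\<close>, the center of
  the inner square on that side (\<open>inner_vecten_point_height_eq_base\<close>); the position of the foot
  of the altitude does not matter. So \<open>F, G, H, I = E + (\<plusminus> q \<plusminus> p)/2\<close> form a square with sides
  \<open>p\<close> and \<open>q\<close>, and the Varignon parallelogram, with vertices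
  \<open>(Z + E)/2 + (\<plusminus> q \<plusminus> p)/2\<close>, is a translate of it. Finally a
  quadrilateral with perpendicular diagonals has half their product as its area
  (\<open>quad_area_perpendicular_diagonals\<close>); the diagonals of the kite have length \<open>2\<bar>q\<bar>\<close>, those of
  the square \<open>\<surd>2 \<bar>q\<bar>\<close>.
\<close>

section \<open>Vectors of the plane\<close>

lemma inner_plane: "x \<bullet> y = x$1 * y$1 + x$2 * y$2" for x y :: "real^2"
  by (simp add: inner_vec_def sum_2)

lemma orthogonal_imp_parallel:
  fixes p q w :: "real^2"
  assumes "q \<noteq> 0" "p \<noteq> 0" "q \<bullet> p = 0" "w \<bullet> p = 0"
  shows "\<exists>t. w = t *\<^sub>R q"
proof (intro exI)
  define n where "n = q \<bullet> q"
  have n: "n > 0" using assms(1) by (simp add: n_def)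
  have det: "w$1 * q$2 - w$2 * q$1 = 0"
  proof -
    have "(w$1 * q$2 - w$2 * q$1) * p$1 = 0" "(w$1 * q$2 - w$2 * q$1) * p$2 = 0"
      using assms(3,4) unfolding inner_plane by algebra+
    moreover have "p$1 \<noteq> 0 \<or> p$2 \<noteq> 0"
      using assms(2) by (simp add: vec_eq_iff forall_2)
    ultimately show ?thesis by auto
  qed
  have "n *\<^sub>R w = (w \<bullet> q) *\<^sub>R q"
    unfolding vec_eq_iff forall_2 n_def inner_plane vector_scaleR_component real_scaleR_def
    using det by (intro conjI; algebra)
  then have "(1 / n) *\<^sub>R (n *\<^sub>R w) = (1 / n) *\<^sub>R ((w \<bullet> q) *\<^sub>R q)" by simp
  then show "w = ((w \<bullet> q) / n) *\<^sub>R q" using n by simp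
qed

lemma mem_affine_hull_2:
  "x \<in> affine hull {a, b} \<longleftrightarrow> (\<exists>t. x = a + t *\<^sub>R (b - a))" for a b :: "'a::real_vector"
  by (force simp: affine_hull_2_alt)

section \<open>Inner Vecten points\<close>

text \<open>If a normal \<open>w\<close> to \<open>QR\<close> took opposite signs at \<open>P\<close> and \<open>S\<close>, it would vanish somewhere on the
  segment \<open>PS\<close>, and that point would lie on the line \<open>QR\<close>. This turns the incidence condition
  \<open>same_side\<close> into an inequality.\<close>
lemma same_side_imp_same_normal_sign:
  assumes ss: "same_side Q R P S"
    and QR: "Q \<noteq> R"
    and w: "w \<bullet> (R - Q) = 0" "w \<bullet> (S - Q) > 0"
  shows "w \<bullet> (P - Q) > 0"
proof (rule ccontr)
  assume "\<not> ?thesis"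
  then have le: "w \<bullet> (P - Q) \<le> 0" by simp
  \<comment> \<open>On the segment from \<open>P\<close> to \<open>S\<close> the functional \<open>w\<close> runs affinely from \<open>- a\<close> to \<open>b\<close>, hence
    vanishes at the parameter \<open>a / (a + b)\<close>.\<close>
  define a where "a = - (w \<bullet> (P - Q))"
  define b where "b = w \<bullet> (S - Q)"
  define t where "t = a / (a + b)"
  have ab: "a \<ge> 0" "b > 0" using le w by (auto simp: a_def b_def)
  then have t: "0 \<le> t" "t \<le> 1" by (auto simp: t_def)
  define x where "x = (1 - t) *\<^sub>R P + t *\<^sub>R S"
  have xseg: "x \<in> closed_segment P S"
    using t by (auto simp: x_def in_segment)
  have "x - Q = (1 - t) *\<^sub>R (P - Q) + t *\<^sub>R (S - Q)"
    by (simp add: x_def algebra_simps)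
  then have "(x - Q) \<bullet> w = (1 - t) * (- a) + t * b"
    by (simp add: inner_add_right inner_commute[of _ w] a_def b_def)
  also have "\<dots> = t * (a + b) - a" by (simp add: algebra_simps)
  also have "\<dots> = 0" using ab by (simp add: t_def)
  finally have "(x - Q) \<bullet> w = 0" .
  moreover have "w \<noteq> 0" using w by auto
  ultimately obtain s where "x - Q = s *\<^sub>R (R - Q)"
    using orthogonal_imp_parallel[of "R - Q" w "x - Q"] QR w
    by (auto simp: inner_commute)
  then have "x = Q + s *\<^sub>R (R - Q)" by (simp add: algebra_simps)
  then have "x \<in> affine hull {Q, R}" unfolding mem_affine_hull_2 by blast
  with xseg ss show False by (auto simp: same_side_def)
qed

text \<open>The side \<open>RS\<close> of the inner square is the only vector normal to \<open>QR\<close>, of the length of \<open>QR\<close>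
  and pointing towards \<open>P\<close>, so any explicit vector \<open>w\<close> with these properties gives the center. The
  conditions on \<open>w\<close> stay true when \<open>Q\<close> and \<open>R\<close> are exchanged, which makes the orientation of the
  triangle irrelevant below.\<close>
lemma inner_square_center_eq:
  assumes M: "inner_square_center P Q R M"
    and w: "w \<bullet> (R - Q) = 0" "norm w = norm (R - Q)" "w \<bullet> (P - Q) > 0"
  shows "M = midpoint Q R + (1/2) *\<^sub>R w"
proof -
  obtain S T where sq: "square Q R S T" and ss: "same_side Q R P S" and MS: "M = midpoint Q S"
    using M unfolding inner_square_center_def by blast
  define v where "v = S - R"
  have QR: "Q \<noteq> R" using sq by (simp add: square_def)
  have orth: "v \<bullet> (R - Q) = 0"
    using sq by (simp add: square_def v_def orthogonal_def inner_diff_left inner_diff_right inner_commute)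
  have nv: "norm v = norm (R - Q)"
    using sq by (simp add: square_def v_def dist_norm norm_minus_commute)
  have "v \<bullet> (S - Q) = v \<bullet> v + v \<bullet> (R - Q)"
    by (simp add: v_def inner_diff_right)
  then have "v \<bullet> (S - Q) > 0" using orth nv QR by (simp add: dot_square_norm)
  then have pos: "v \<bullet> (P - Q) > 0"
    using same_side_imp_same_normal_sign[OF ss QR orth] by simp
  have "w \<noteq> 0" using w by auto
  then obtain t where t: "v = t *\<^sub>R w"
    using orthogonal_imp_parallel[of w "R - Q" v] QR w orth by auto
  have "\<bar>t\<bar> = 1" using nv w QR t by simp
  moreover have "t > 0" using pos t w(3) by (simp add: zero_less_mult_iff)
  ultimately have "v = w" using t by simp
  then have "S = R + w" by (simp add: v_def algebra_simps)
  then show ?thesis by (simp add: MS midpoint_def algebra_simps)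
qed

lemma inner_vecten_point_rotate:
  "inner_vecten_point P Q R X \<Longrightarrow> inner_vecten_point Q R P X"
  unfolding inner_vecten_point_def by blast

lemma inner_vecten_point_cevian:
  assumes "inner_vecten_point P Q R X"
    and "w \<bullet> (R - Q) = 0" "norm w = norm (R - Q)" "w \<bullet> (P - Q) > 0"
  shows "\<exists>t. X = P + t *\<^sub>R (midpoint Q R + (1/2) *\<^sub>R w - P)"
  using assms inner_square_center_eq mem_affine_hull_2
  unfolding inner_vecten_point_def by (metis IntE)

text \<open>Here \<open>EB = u\<close> is the base and \<open>v\<close> the altitude vector of \<open>A\<close>. With the inner squares in
  explicit form, the cevian from \<open>E\<close> has direction \<open>u + v\<close> and the one from \<open>B\<close> has direction
  \<open>v - u\<close>, whatever the foot \<open>E + l u\<close> of the altitude is; these are the diagonals of the square on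
  \<open>EB\<close>, so they meet in its center. When \<open>l\<close> makes a square center coincide with a vertex, one of the
  lines degenerates to that vertex, which still lies on the diagonal in question. The
  two orders of \<open>A\<close> and \<open>B\<close> cover both orientations of the triangles around \<open>E\<close>.\<close>
lemma inner_vecten_point_height_eq_base:
  assumes vec: "inner_vecten_point E A B F \<or> inner_vecten_point E B A F"
    and B: "B = E + u" and A: "A = E + l *\<^sub>R u + v"
    and uv: "u \<bullet> v = 0" "norm u = norm v" "u \<noteq> 0"
  shows "F = E + (1/2) *\<^sub>R (u + v)"
proof -
  define n where "n = u \<bullet> u"
  have n: "n > 0" using uv by (simp add: n_def)
  have ip: "u \<bullet> u = n" "v \<bullet> v = n" "u \<bullet> v = 0" "v \<bullet> u = 0"
    using uv by (auto simp: n_def inner_commute norm_eq)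
  note inner_simps = inner_add_left inner_add_right inner_diff_left inner_diff_right ip
  \<comment> \<open>\<open>w1\<close> and \<open>w2\<close> are the sides \<open>AB\<close> and \<open>EA\<close> turned by a right angle, towards \<open>E\<close> and
    towards \<open>B\<close> respectively.\<close>
  define w1 where "w1 = - (u + (1 - l) *\<^sub>R v)"
  define w2 where "w2 = u - l *\<^sub>R v"
  have w1: "w1 \<bullet> (B - A) = 0" "norm w1 = norm (B - A)" "w1 \<bullet> (E - A) > 0"
    "w1 \<bullet> (A - B) = 0" "norm w1 = norm (A - B)" "w1 \<bullet> (E - B) > 0"
    unfolding w1_def A B norm_eq using n by (simp_all add: inner_simps algebra_simps)
  have w2: "w2 \<bullet> (A - E) = 0" "norm w2 = norm (A - E)" "w2 \<bullet> (B - E) > 0"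
    "w2 \<bullet> (E - A) = 0" "norm w2 = norm (E - A)" "w2 \<bullet> (B - A) > 0"
    unfolding w2_def A B norm_eq using n by (simp_all add: inner_simps algebra_simps)
  have "\<exists>t. F = E + t *\<^sub>R (midpoint A B + (1/2) *\<^sub>R w1 - E)"
    using vec inner_vecten_point_cevian[OF _ w1(1-3)] inner_vecten_point_cevian[OF _ w1(4-6)]
    unfolding midpoint_sym[of B A] by blast
  moreover have "midpoint A B + (1/2) *\<^sub>R w1 - E = (l/2) *\<^sub>R (u + v)"
    unfolding midpoint_def A B w1_def
    by (simp add: vec_eq_iff field_simps)
  ultimately obtain s where s: "F = E + s *\<^sub>R (u + v)" by auto
  have "inner_vecten_point B E A F \<or> inner_vecten_point B A E F"
    using vec inner_vecten_point_rotate by meson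
  then have "\<exists>t. F = B + t *\<^sub>R (midpoint E A + (1/2) *\<^sub>R w2 - B)"
    using inner_vecten_point_cevian[OF _ w2(1-3)] inner_vecten_point_cevian[OF _ w2(4-6)]
    unfolding midpoint_sym[of A E] by blast
  moreover have "midpoint E A + (1/2) *\<^sub>R w2 - B = ((1 - l)/2) *\<^sub>R (v - u)"
    unfolding midpoint_def A B w2_def
    by (simp add: vec_eq_iff field_simps)
  ultimately obtain t where t: "F = B + t *\<^sub>R (v - u)" by auto
  have eq: "s *\<^sub>R (u + v) = u + t *\<^sub>R (v - u)"
    using s t B by (simp add: add.assoc)
  have "s * n = n - t * n" using arg_cong[OF eq, of "\<lambda>z. z \<bullet> u"] by (simp add: inner_simps algebra_simps)
  moreover have "s * n = t * n" using arg_cong[OF eq, of "\<lambda>z. z \<bullet> v"] by (simp add: inner_simps algebra_simps)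
  ultimately have "s = 1/2" using n by auto
  then show ?thesis using s by simp
qed

section \<open>The Steiner point of an equidiagonal kite\<close>

text \<open>Let \<open>M\<close> be the midpoint of \<open>BD\<close>. It is the midpoint used by the midray circles of both \<open>B\<close> and
  \<open>D\<close>. Each center has the form \<open>M + y q\<close>, with \<open>y > 0\<close> for \<open>B\<close> and \<open>y < 0\<close> for \<open>D\<close>, so
  the circles lie on opposite sides of the common tangent at \<open>M\<close>, and \<open>M\<close> is their only common
  point.\<close>
lemma steiner_point_kite:
  fixes Z :: point
  assumes st: "steiner_point A B C D E"
    and ABCD: "A = Z + p" "C = Z - p" "B = Z + b *\<^sub>R q" "D = Z + (b - 2) *\<^sub>R q"
    and pq: "p \<bullet> q = 0" "norm p = norm q" "p \<noteq> 0"
    and b: "0 < b" "b < 2"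
  shows "E = Z + (b - 1) *\<^sub>R q"
proof -
  define M where "M = Z + (b - 1) *\<^sub>R q"
  define n where "n = p \<bullet> p"
  have n: "n > 0" using pq by (simp add: n_def)
  have ip: "p \<bullet> p = n" "q \<bullet> q = n" "p \<bullet> q = 0" "q \<bullet> p = 0"
    using pq by (auto simp: n_def inner_commute norm_eq)
  note inner_simps = inner_add_left inner_add_right inner_diff_left inner_diff_right ip
  have q0: "q \<noteq> 0" using pq by auto
  \<comment> \<open>Both circles at once: \<open>h q / 2\<close> is the position, relative to \<open>M\<close>, of the chord joining the
    midpoints of \<open>VA\<close> and \<open>VC\<close>, so \<open>h = 2 - b\<close> for \<open>V = B\<close> and \<open>h = - b\<close> for \<open>V = D\<close>. The center lies
    on the same side of \<open>M\<close> as this chord.\<close>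
  have circle: "\<exists>y. y * h > 0 \<and> (E - M) \<bullet> (E - M) = 2 * y * (q \<bullet> (E - M))"
    if K: "E \<in> K" "midpoint V A \<in> K" "midpoint V C \<in> K" "M \<in> K" "K = sphere c r"
      and V: "V = Z + (h + 2 * b - 2) *\<^sub>R q" for V K c r h
  proof -
    define z where "z = c - M"
    have chord: "(X - M) \<bullet> (X - M) = 2 * (z \<bullet> (X - M))" if "X \<in> K" for X
    proof -
      have "dist c X = dist c M" using that K by simp
      then have "norm (z - (X - M)) = norm z" by (simp add: z_def dist_norm)
      then have "(z - (X - M)) \<bullet> (z - (X - M)) = z \<bullet> z" by (simp only: norm_eq)
      then show ?thesis by (simp add: inner_diff_left inner_diff_right inner_commute)
    qed
    have mA: "midpoint V A - M = (1/2) *\<^sub>R (h *\<^sub>R q + p)"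
     and mC: "midpoint V C - M = (1/2) *\<^sub>R (h *\<^sub>R q - p)"
      unfolding midpoint_def V ABCD M_def by (simp_all add: vec_eq_iff field_simps)
    have "n / 4 + h * (h * n) / 4 = h * (z \<bullet> q) + z \<bullet> p"
      using chord[OF K(2)] unfolding mA by (simp add: inner_simps algebra_simps)
    moreover have "n / 4 + h * (h * n) / 4 = h * (z \<bullet> q) - z \<bullet> p"
      using chord[OF K(3)] unfolding mC by (simp add: inner_simps algebra_simps)
    ultimately have zp: "z \<bullet> p = 0" and zq: "h * (z \<bullet> q) = (n + h * (h * n)) / 4" by auto
    obtain y where y: "z = y *\<^sub>R q"
      using orthogonal_imp_parallel[OF q0 pq(3) ip(4) zp] by blast
    have "n + h * (h * n) = n * (1 + h\<^sup>2)" by (simp add: algebra_simps power2_eq_square)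
    also have "\<dots> > 0" using n by (simp add: add_pos_nonneg)
    finally have "n * (y * h) > 0" using zq y by (simp add: ip algebra_simps)
    then have "y * h > 0" using n by (simp add: zero_less_mult_iff)
    then show ?thesis using chord[OF K(1)] y by auto
  qed
  have M: "midpoint B D = M"
    unfolding midpoint_def ABCD M_def by (simp add: vec_eq_iff field_simps)
  obtain K K' where mc: "midray_circle B C D A K" "midray_circle D A B C K'"
    and EK: "E \<in> K" "E \<in> K'"
    using st unfolding steiner_point_def by blast
  have K: "midpoint B A \<in> K" "midpoint B C \<in> K" "M \<in> K"
    and K': "midpoint D A \<in> K'" "midpoint D C \<in> K'" "M \<in> K'"
    using mc M unfolding midray_circle_def by (auto simp: midpoint_sym[of D B])
  obtain c r c' r' where KS: "K = sphere c r" "K' = sphere c' r'"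
    using mc unfolding midray_circle_def by blast
  obtain y where y: "y * (2 - b) > 0" "(E - M) \<bullet> (E - M) = 2 * y * (q \<bullet> (E - M))"
    using circle[OF EK(1) K KS(1), of "2 - b"] ABCD(3) by auto
  obtain y' where y': "y' * (- b) > 0" "(E - M) \<bullet> (E - M) = 2 * y' * (q \<bullet> (E - M))"
    using circle[OF EK(2) K' KS(2), of "- b"] ABCD(4) by auto
  have "y > 0" "y' < 0" using y y' b by (auto simp: zero_less_mult_iff mult_less_0_iff)
  moreover from this have "q \<bullet> (E - M) = 0" using y(2) y'(2) by auto
  ultimately have "E - M = 0" using y(2) by simp
  then show ?thesis by (simp add: M_def)
qed

section \<open>Areas\<close>

text \<open>In a convex combination with weights \<open>b\<close> at \<open>B\<close> and \<open>d\<close> at \<open>D\<close>, the smaller contribution can be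
  cancelled: moving weight from \<open>B\<close> and \<open>D\<close> to \<open>P\<close>, in the ratio that defines \<open>P\<close>, and from there to
  \<open>A\<close> and \<open>C\<close>, removes \<open>B\<close> or \<open>D\<close> from the combination.\<close>
lemma convex_hull_4_subset:
  fixes A B C D P :: "'a::real_vector"
  assumes P: "P \<in> open_segment A C" "P \<in> open_segment B D"
  shows "convex hull {A, B, C, D} \<subseteq> convex hull {A, B, C} \<union> convex hull {A, C, D}"
proof
  fix x assume "x \<in> convex hull {A, B, C, D}"
  then have "x \<in> convex hull (insert D {A, B, C})" by (simp add: insert_commute)
  then obtain d e y where de: "d \<ge> 0" "e \<ge> 0" "d + e = 1" "y \<in> convex hull {A, B, C}"
    and x: "x = d *\<^sub>R D + e *\<^sub>R y" by (subst (asm) convex_hull_insert) auto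
  obtain a' b' c' where abc: "a' \<ge> 0" "b' \<ge> 0" "c' \<ge> 0" "a' + b' + c' = 1"
    and y: "y = a' *\<^sub>R A + b' *\<^sub>R B + c' *\<^sub>R C"
    using de(4) unfolding convex_hull_3 by auto
  define a b c where "a = e * a'" "b = e * b'" "c = e * c'"
  have nn: "a \<ge> 0" "b \<ge> 0" "c \<ge> 0" using abc de by (auto simp: a_b_c_def)
  have "a + b + c = e * (a' + b' + c')" by (simp add: a_b_c_def algebra_simps)
  then have sum: "a + b + c + d = 1" using abc de by simp
  have x': "x = a *\<^sub>R A + b *\<^sub>R B + c *\<^sub>R C + d *\<^sub>R D"
    by (simp add: x y a_b_c_def algebra_simps)
  \<comment> \<open>Stated for arbitrary \<open>B\<close> and \<open>D\<close>, since it is used a second time with the two exchanged.\<close>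
  have key: "x \<in> convex hull {A, B, C}"
    if "P = (1 - t) *\<^sub>R B + t *\<^sub>R D" "0 < t" "t < 1" "d * (1 - t) \<le> b * t" "b \<ge> 0" "d \<ge> 0" 
      "a + b + c + d = 1" "x = a *\<^sub>R A + b *\<^sub>R B + c *\<^sub>R C + d *\<^sub>R D" for B D :: 'a and b d t
  proof -
    obtain s where s: "0 < s" "s < 1" "P = (1 - s) *\<^sub>R A + s *\<^sub>R C"
      using P(1) by (auto simp: in_segment)
    define k where "k = d / t"
    have d: "d = k * t" and k: "k \<ge> 0" using that by (auto simp: k_def)
    have kP: "k *\<^sub>R ((1 - s) *\<^sub>R A + s *\<^sub>R C) = k *\<^sub>R ((1 - t) *\<^sub>R B + t *\<^sub>R D)"
      using that(1) s(3) by simp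
    have "x = (a + k * (1 - s)) *\<^sub>R A + (b - k * (1 - t)) *\<^sub>R B + (c + k * s) *\<^sub>R C"
      using kP unfolding that(8) d by (simp add: algebra_simps)
    moreover have "a + k * (1 - s) \<ge> 0" "c + k * s \<ge> 0" using nn k s by auto
    moreover have "t * (k * (1 - t)) \<le> t * b" using that(4) by (simp add: d algebra_simps)
    then have "b - k * (1 - t) \<ge> 0" using \<open>0 < t\<close> by simp
    moreover have "(a + k * (1 - s)) + (b - k * (1 - t)) + (c + k * s) = 1"
      using that(7) by (simp add: d algebra_simps)
    ultimately show ?thesis unfolding convex_hull_3 by blast
  qed
  obtain t where t: "0 < t" "t < 1" "P = (1 - t) *\<^sub>R B + t *\<^sub>R D"
    using P(2) by (auto simp: in_segment)
  show "x \<in> convex hull {A, B, C} \<union> convex hull {A, C, D}"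
  proof (cases "d * (1 - t) \<le> b * t")
    case True
    then show ?thesis using key[of t B D d b] t x' sum nn de by auto
  next
    case False
    then have "x \<in> convex hull {A, D, C}"
      using key[of "1 - t" D B b d] t x' sum nn de by (simp add: algebra_simps)
    then show ?thesis by (simp add: insert_commute)
  qed
qed

lemma lebesgue_measure_triangle:
  fixes A B C :: point
  shows "measure lebesgue (convex hull {A, B, C}) =
    \<bar>(C$1 - A$1) * (B$2 - A$2) - (B$1 - A$1) * (C$2 - A$2)\<bar> / 2"
proof -
  have "compact (convex hull {A, B, C})"
    by (intro compact_convex_hull finite_imp_compact) simp
  then show ?thesis
    by (simp add: measure_completion borel_compact content_triangle)
qed

text \<open>The diagonal \<open>AC\<close> cuts the quadrilateral into two triangles that overlap only in a null set. Their
  areas are the fractions \<open>t\<close> and \<open>1 - t\<close>, in which \<open>P\<close> divides \<open>BD\<close>, of half the determinant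
  of the diagonals; by perpendicularity that determinant is the product of their lengths.\<close>
lemma quad_area_perpendicular_diagonals:
  fixes A B C D P :: point
  assumes P: "P \<in> open_segment A C" "P \<in> open_segment B D"
    and perp: "(C - A) \<bullet> (D - B) = 0"
  shows "quad_area A B C D = dist A C * dist B D / 2"
proof -
  define u where "u = C - A"
  define w where "w = B - D"
  have uw: "u \<bullet> w = 0" "w \<bullet> u = 0"
    using perp by (auto simp: u_def w_def inner_diff_right inner_diff_left inner_commute)
  obtain s where s: "0 < s" "s < 1" "P = (1 - s) *\<^sub>R A + s *\<^sub>R C"
    using P(1) by (auto simp: in_segment)
  obtain t where t: "0 < t" "t < 1" "P = (1 - t) *\<^sub>R B + t *\<^sub>R D" "B \<noteq> D"
    using P(2) by (auto simp: in_segment)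
  have w0: "w \<noteq> 0" using t by (simp add: w_def)
  have coords: "C = A + u" "B = A + s *\<^sub>R u + t *\<^sub>R w" "D = A + s *\<^sub>R u - (1 - t) *\<^sub>R w"
    using s(3) t(3) by (simp_all add: u_def w_def algebra_simps)
  let ?k = "w \<bullet> A"
  have "{A, B, C} \<subseteq> {x. w \<bullet> x \<ge> ?k}"
    using t uw unfolding coords by (simp add: inner_add_right)
  then have above: "convex hull {A, B, C} \<subseteq> {x. w \<bullet> x \<ge> ?k}"
    by (rule hull_minimal) (rule convex_halfspace_ge)
  have "{A, C, D} \<subseteq> {x. w \<bullet> x \<le> ?k}"
    using t uw unfolding coords by (simp add: inner_add_right inner_diff_right)
  then have below: "convex hull {A, C, D} \<subseteq> {x. w \<bullet> x \<le> ?k}"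
    by (rule hull_minimal) (rule convex_halfspace_le)
  have "convex hull {A, B, C} \<inter> convex hull {A, C, D} \<subseteq> {x. w \<bullet> x = ?k}"
    using above below by fastforce
  then have null: "negligible (convex hull {A, B, C} \<inter> convex hull {A, C, D})"
    using negligible_hyperplane[of w ?k] w0 negligible_subset by blast
  have split: "convex hull {A, B, C, D} = convex hull {A, B, C} \<union> convex hull {A, C, D}"
    by (intro equalityI convex_hull_4_subset[OF P] Un_least hull_mono) auto
  have "quad_area A B C D = measure lebesgue (convex hull {A, B, C}) + measure lebesgue (convex hull {A, C, D})"
    unfolding quad_area_def quad_region_def split
    using null by (subst measure_Un3) 
      (auto simp: negligible_imp_measure0 intro!: measurable_convex bounded_convex_hull convex_convex_hull)
  also define c where "c = u$1 * w$2 - u$2 * w$1"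
  have "measure lebesgue (convex hull {A, B, C}) = t * \<bar>c\<bar> / 2"
  proof -
    have "(C$1 - A$1) * (B$2 - A$2) - (B$1 - A$1) * (C$2 - A$2) = t * c"
      unfolding coords c_def by (simp add: algebra_simps)
    then show ?thesis using t by (simp add: lebesgue_measure_triangle abs_mult)
  qed
  also have "measure lebesgue (convex hull {A, C, D}) = (1 - t) * \<bar>c\<bar> / 2"
  proof -
    have "(D$1 - A$1) * (C$2 - A$2) - (C$1 - A$1) * (D$2 - A$2) = (1 - t) * c"
      unfolding coords c_def by (simp add: algebra_simps)
    then show ?thesis using t by (simp add: lebesgue_measure_triangle abs_mult)
  qed
  also have "t * \<bar>c\<bar> / 2 + (1 - t) * \<bar>c\<bar> / 2 = \<bar>c\<bar> / 2"
    by (simp add: field_simps)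
  also have "\<bar>c\<bar> = norm u * norm w"
  proof -
    \<comment> \<open>Lagrange's identity\<close>
    have "c\<^sup>2 + (u \<bullet> w)\<^sup>2 = (u \<bullet> u) * (w \<bullet> w)"
      unfolding c_def inner_plane by algebra
    then have "\<bar>c\<bar>\<^sup>2 = (norm u * norm w)\<^sup>2"
      using uw by (simp add: power2_norm_eq_inner power_mult_distrib)
    then show ?thesis by (rule power2_eq_imp_eq) simp_all
  qed
  finally show ?thesis by (simp add: u_def w_def dist_norm norm_minus_commute)
qed

section \<open>Convex equidiagonal kites and their inner Vecten points\<close>

text \<open>Both \<open>B\<close> and \<open>D\<close> are equidistant from \<open>A\<close> and \<open>C\<close>, hence on the perpendicular bisector of \<open>AC\<close>;
  the difference \<open>2\<close> of their coordinates reflects the equality of the diagonals. Convexity is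
  what places \<open>Z\<close> strictly between \<open>B\<close> and \<open>D\<close>: otherwise the kite would be a dart or degenerate, and a
  side line would meet the opposite side.\<close>
lemma convex_equidiagonal_kite_frame:
  assumes conv: "convex_quadrilateral A B C D"
    and eqd: "equidiagonal A B C D"
    and AB: "dist A B = dist B C"
    and AD: "dist A D = dist C D"
  obtains Z p q b where
    "A = Z + p" "C = Z - p" "B = Z + b *\<^sub>R q" "D = Z + (b - 2) *\<^sub>R q"
    "p \<bullet> q = 0" "norm p = norm q" "p \<noteq> 0" "0 < b" "b < 2"
proof -
  define Z where "Z = midpoint A C"
  define p where "p = A - Z"
  define q where "q = (1/2) *\<^sub>R (B - D)"
  have disj: "X \<in> closed_segment C D \<Longrightarrow> X \<notin> affine hull {A, B}"
    "X \<in> closed_segment A B \<Longrightarrow> X \<notin> affine hull {C, D}" for X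
    using conv by (auto simp: convex_quadrilateral_def same_side_def)
  have AC: "A = Z + p" "C = Z - p"
    by (simp_all add: p_def Z_def midpoint_def vec_eq_iff field_simps)
  have "A \<noteq> C"
    using disj(1)[of C] by (auto simp: mem_affine_hull_2)
  then have p0: "p \<noteq> 0" using AC by auto
  have equidist: "(V - Z) \<bullet> p = 0" if "dist V A = dist V C" for V
  proof -
    have "norm ((V - Z) - p) = norm ((V - Z) + p)"
      using that by (simp add: AC dist_norm algebra_simps)
    then show ?thesis
      unfolding norm_eq by (simp add: inner_add_left inner_add_right inner_diff_left inner_diff_right inner_commute)
  qed
  have Bp: "(B - Z) \<bullet> p = 0" and Dp: "(D - Z) \<bullet> p = 0"
    using AB AD by (auto intro!: equidist simp: dist_commute)
  have qp: "q \<bullet> p = 0"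
    using Bp Dp by (simp add: q_def inner_diff_left)
  have "A - C = 2 *\<^sub>R p" by (simp add: AC scaleR_2)
  then have nq: "norm p = norm q"
    using eqd by (simp add: equidiagonal_def dist_norm q_def)
  then have "q \<noteq> 0" using p0 by auto
  then obtain b where "B - Z = b *\<^sub>R q"
    using orthogonal_imp_parallel[OF _ p0 qp Bp] by blast
  then have B: "B = Z + b *\<^sub>R q" by (simp add: algebra_simps)
  have "B - D = 2 *\<^sub>R q" by (simp add: q_def)
  then have D: "D = Z + (b - 2) *\<^sub>R q" using B by (simp add: algebra_simps)
  have "0 < b"
  proof (rule ccontr)
    assume "\<not> 0 < b"
    then have b: "b \<le> 0" by simp
    \<comment> \<open>\<open>X\<close> is the intersection of the line \<open>AB\<close> with the segment \<open>CD\<close>, at parameter \<open>s\<close>.\<close>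
    define s where "s = b / (b - 1)"
    have sb: "s * (b - 1) = b" using b by (simp add: s_def)
    have s: "0 \<le> s" "s \<le> 1" using b by (auto simp: s_def divide_nonpos_neg field_simps)
    define X where "X = Z - (1 - s) *\<^sub>R p + (s * (b - 2)) *\<^sub>R q"
    have "X = (1 - s) *\<^sub>R C + s *\<^sub>R D"
      by (simp add: X_def AC D algebra_simps)
    then have "X \<in> closed_segment C D" using s by (auto simp: in_segment)
    moreover have e: "s * (b - 2) = (2 - s) * b" using sb by (simp add: algebra_simps)
    have "X = A + (2 - s) *\<^sub>R (B - A)"
      unfolding X_def e AC B by (simp add: vec_eq_iff algebra_simps)
    then have "X \<in> affine hull {A, B}" unfolding mem_affine_hull_2 by blast
    ultimately show False using disj by blast
  qed
  moreover have "b < 2"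
  proof (rule ccontr)
    assume "\<not> b < 2"
    then have b: "b \<ge> 2" by simp
    \<comment> \<open>The same with the roles of the lines exchanged: the line \<open>CD\<close> meets the segment \<open>AB\<close>.\<close>
    define s where "s = (b - 2) / (b - 1)"
    have sb: "s * (b - 1) = b - 2" using b by (simp add: s_def)
    have s: "0 \<le> s" "s \<le> 1" using b by (auto simp: s_def field_simps)
    define X where "X = Z + (1 - s) *\<^sub>R p + (s * b) *\<^sub>R q"
    have "X = (1 - s) *\<^sub>R A + s *\<^sub>R B"
      by (simp add: X_def AC B algebra_simps)
    then have "X \<in> closed_segment A B" using s by (auto simp: in_segment)
    moreover have e: "s * b = (2 - s) * (b - 2)" using sb by (simp add: algebra_simps)
    have "X = C + (2 - s) *\<^sub>R (D - C)"
      unfolding X_def e AC D by (simp add: vec_eq_iff algebra_simps)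
    then have "X \<in> affine hull {C, D}" unfolding mem_affine_hull_2 by blast
    ultimately show False using disj by blast
  qed
  ultimately show thesis
    using that[OF AC B D] qp nq p0 by (simp add: inner_commute)
qed

theorem theorem10p9:
  fixes A B C D E F G H I :: point
  assumes "convex_quadrilateral A B C D"
    and "kite A B C D"
    and "equidiagonal A B C D"
    and "dist A B = dist B C"
    and "dist A D = dist C D"
    and "steiner_point A B C D E"
    and "inner_vecten_point E A B F"
    and "inner_vecten_point E B C G"
    and "inner_vecten_point E C D H"
    and "inner_vecten_point E D A I"
  shows "square F G H I \<and>
         congruent_figures (quad_region F G H I) (varignon_region A B C D) \<and>
         quad_area A B C D = 2 * quad_area F G H I"
proof -
  obtain Z p q b where
    ABCD: "A = Z + p" "C = Z - p" "B = Z + b *\<^sub>R q" "D = Z + (b - 2) *\<^sub>R q"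
    and pq: "p \<bullet> q = 0" "norm p = norm q" "p \<noteq> 0" and b: "0 < b" "b < 2"
    by (rule convex_equidiagonal_kite_frame[OF assms(1,3,4,5)])
  have q0: "q \<noteq> 0" using pq by auto
  have pp: "p \<bullet> p = q \<bullet> q" and qp: "q \<bullet> p = 0"
    using pq by (auto simp: inner_commute norm_eq)
  note inner_simps = inner_add_left inner_add_right inner_diff_left inner_diff_right pp qp pq(1)
  have E: "E = Z + (b - 1) *\<^sub>R q"
    by (rule steiner_point_kite[OF assms(6) ABCD pq b])
  \<comment> \<open>The vertices as seen from \<open>E\<close>, with base \<open>q\<close> (to \<open>B\<close>) or \<open>- q\<close> (to \<open>D\<close>) and altitude
    \<open>p\<close> or \<open>- p\<close>.\<close>
  have EABCD: "B = E + q" "D = E + - q" "A = E + (1 - b) *\<^sub>R q + p" "C = E + (1 - b) *\<^sub>R q + - p"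
    "A = E + (b - 1) *\<^sub>R (- q) + p" "C = E + (b - 1) *\<^sub>R (- q) + - p"
    unfolding ABCD E by (simp_all add: algebra_simps scaleR_2)
  have F: "F = E + (1/2) *\<^sub>R (q + p)"
    using inner_vecten_point_height_eq_base[OF _ EABCD(1,3)] assms(7) pq q0 qp by auto
  have G: "G = E + (1/2) *\<^sub>R (q + - p)"
    using inner_vecten_point_height_eq_base[OF _ EABCD(1,4)] assms(8) pq q0 qp by auto
  have H: "H = E + (1/2) *\<^sub>R (- q + - p)"
    using inner_vecten_point_height_eq_base[OF _ EABCD(2,6)] assms(9) pq q0 qp by auto
  have I: "I = E + (1/2) *\<^sub>R (- q + p)"
    using inner_vecten_point_height_eq_base[OF _ EABCD(2,5)] assms(10) pq q0 qp by auto
  have sides: "G - F = - p" "H - G = - q" "I - H = p" "F - I = q"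
    unfolding F G H I by (simp_all add: vec_eq_iff field_simps)
  have "square F G H I"
  proof -
    have rev: "F - G = p" "G - H = q" "H - I = - p" "I - F = - q"
      unfolding F G H I by (simp_all add: vec_eq_iff field_simps)
    moreover have "F \<noteq> G" using rev pq by auto
    ultimately show ?thesis
      using pq qp unfolding square_def dist_norm orthogonal_def sides rev by auto
  qed
  moreover have "congruent_figures (quad_region F G H I) (varignon_region A B C D)"
    unfolding congruent_figures_def
  proof (intro exI conjI allI)
    define m where "m = (1/2) *\<^sub>R (Z - E)"
    have "midpoint A B = m + F" "midpoint B C = m + G" "midpoint C D = m + H" "midpoint D A = m + I"
      unfolding m_def midpoint_def F G H I E ABCD by (simp_all add: vec_eq_iff field_simps)
    then show "(+) m ` quad_region F G H I = varignon_region A B C D"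
      by (simp add: varignon_region_def quad_region_def convex_hull_translation[symmetric])
    show "dist (m + x) (m + y) = dist x y" for x y by simp
  qed
  moreover have "quad_area A B C D = 2 * quad_area F G H I"
  proof -
    have diag: "C - A = - (2 *\<^sub>R p)" "D - B = - (2 *\<^sub>R q)"
      unfolding ABCD by (simp_all add: algebra_simps scaleR_2)
    then have "A \<noteq> C" "B \<noteq> D" using pq q0 by auto
    moreover have "Z = (1 - 1/2) *\<^sub>R A + (1/2) *\<^sub>R C" "Z = (1 - b/2) *\<^sub>R B + (b/2) *\<^sub>R D"
      unfolding ABCD by (simp_all add: vec_eq_iff field_simps)
    moreover have "0 < (1/2::real)" "(1/2::real) < 1" "0 < b/2" "b/2 < 1" using b by auto
    ultimately have "Z \<in> open_segment A C" "Z \<in> open_segment B D"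
      unfolding in_segment by blast+
    then have "quad_area A B C D = dist A C * dist B D / 2"
      using quad_area_perpendicular_diagonals diag pq by simp
    also have "\<dots> = 2 * (q \<bullet> q)"
      unfolding dist_norm norm_minus_commute[of A] norm_minus_commute[of B] diag
      using pq by (simp add: dot_square_norm power2_eq_square)
    finally have "quad_area A B C D = 2 * (q \<bullet> q)" .
    moreover have "quad_area F G H I = q \<bullet> q"
    proof -
      have d: "H - F = - (p + q)" "I - G = p - q"
        unfolding F G H I by (simp_all add: vec_eq_iff field_simps)
      have n: "(p + q) \<bullet> (p + q) = 2 * (q \<bullet> q)" "(p - q) \<bullet> (p - q) = 2 * (q \<bullet> q)"
        by (simp_all add: inner_simps)
      then have "F \<noteq> H" "G \<noteq> I" using d q0 by auto
      moreover have "E = midpoint F H" "E = midpoint G I"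
        unfolding F G H I midpoint_def by (simp_all add: vec_eq_iff field_simps)
      ultimately have "E \<in> open_segment F H" "E \<in> open_segment G I"
        using midpoint_in_open_segment[of F H] midpoint_in_open_segment[of G I] by simp_all
      moreover have "(H - F) \<bullet> (I - G) = 0" unfolding d by (simp add: inner_simps)
      ultimately have "quad_area F G H I = dist F H * dist G I / 2"
        by (rule quad_area_perpendicular_diagonals)
      also have "dist F H * dist G I = norm (p + q) * norm (p - q)"
        unfolding dist_norm norm_minus_commute[of F] norm_minus_commute[of G] d
        by (simp only: norm_minus_cancel)
      also have "norm (p - q) = norm (p + q)" unfolding norm_eq n ..
      also have "norm (p + q) * norm (p + q) = 2 * (q \<bullet> q)"
        using n by (simp add: norm_eq_sqrt_inner)
      finally show ?thesis by simp
    qed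
    ultimately show ?thesis by simp
  qed
  ultimately show ?thesis by blast
qed

end
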